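(* Let $d\ge1$ and $r\ge 1$ be integers, let $\Delta$ be a $(d-1)$-dimensional simplicial complex and let $\Delta_{\mathcal{F}}$ be its $r$-th edgewise subdivision. For a $(d-1)$-dimensional simplicial complex $\Gamma$ consider the conditions (a) $h_0^\Gamma,\ldots,h_d^\Gamma>0$ and $$\frac{h_0^\Gamma}{h_d^\Gamma}\le \frac{h_1^\Gamma}{h_{d-1}^\Gamma}\le\cdots\le\frac{h_{d-1}^\Gamma}{h_1^\Gamma}\le\frac{h_d^\Gamma}{h_0^\Gamma};$$ (b) $h_1^\Gamma,\ldots,h_{d-1}^\Gamma>0$, $h_d^\Gamma=0$ and $$\frac{h_1^\Gamma}{h_{d-1}^\Gamma}\ge\cdots\ge\frac{h_{d-2}^\Gamma}{h_2^\Gamma}\ge\frac{h_{d-1}^\Gamma}{h_1^\Gamma}.$$ If $\Delta$ satisfies (a), then $\Delta_{\mathcal{F}}$ satisfies (a); and if $\Delta$ satisfies (b), then $\Delta_{\mathcal{F}}$ satisfies (b).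
   Context: For a finite $(d-1)$-dimensional simplicial complex $\Delta$, let $f_i^\Delta$ be the number of faces of dimension $i$ (i.e. of cardinality $i+1$), $-1\le i\le d-1$, and define the $h$-vector $h^\Delta=(h_0^\Delta,\ldots,h_d^\Delta)$ by $\sum_{i=0}^d f_{i-1}^\Delta (x-1)^{d-i}=\sum_{i=0}^d h_i^\Delta x^{d-i}$. The $r$-th edgewise subdivision: let $\Delta$ be a simplicial complex with vertex set identified with $\{1,\ldots,n\}$. Let $\Omega_r$ be the set of vectors $a=(a_1,\ldots,a_n)$ of non-negative integers with $a_1+\cdots+a_n=r$, let $\mathrm{supp}(a)=\{k : a_k\ne0\}$, and let $\iota(a)=(a_1,a_1+a_2,\ldots,a_1+\cdots+a_n)$. The $r$-th edgewise subdivision of $\Delta$ is the simplicial complex whose faces are the subsets $S\subseteq\Omega_r$ such that $\bigcup_{a\in S}\mathrm{supp}(a)\in\Delta$ and, for all $a,a'\in S$, $\iota(a)-\iota(a')\in\{0,1\}^n$ or $\iota(a')-\iota(a)\in\{0,1\}^n$. *)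

theory Defs
  imports Complex_Main "HOL-Computational_Algebra.Polynomial"
begin

definition simplicial_complex :: "'a set set \<Rightarrow> bool" where
  "simplicial_complex \<Delta> \<longleftrightarrow>
     finite \<Delta> \<and> {} \<in> \<Delta> \<and> (\<forall>F\<in>\<Delta>. finite F \<and> (\<forall>G. G \<subseteq> F \<longrightarrow> G \<in> \<Delta>))"

definition face_dim :: "'a set \<Rightarrow> int" where
  "face_dim F = int (card F) - 1"

definition complex_dim :: "'a set set \<Rightarrow> int" where
  "complex_dim \<Delta> = Max (face_dim ` \<Delta>)"

definition f_vector :: "'a set set \<Rightarrow> int \<Rightarrow> nat" where
  "f_vector \<Delta> i = card {F \<in> \<Delta>. face_dim F = i}"

definition h_poly :: "'a set set \<Rightarrow> int poly" where
  "h_poly \<Delta> = (let d = nat (complex_dim \<Delta> + 1) in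
     \<Sum>i\<le>d. of_nat (f_vector \<Delta> (int i - 1)) * [:-1, 1:] ^ (d - i))"

definition h_vector :: "'a set set \<Rightarrow> nat \<Rightarrow> int" where
  "h_vector \<Delta> i = coeff (h_poly \<Delta>) (nat (complex_dim \<Delta> + 1) - i)"

text \<open>The numbers \<^term>\<open>h_vector \<Delta> i\<close> satisfy the defining identity of the
  \<open>h\<close>-vector of a \<open>(d-1)\<close>-dimensional complex.\<close>

lemma h_vector_identity:
  fixes x :: int
  assumes "complex_dim \<Delta> = int d - 1"
  shows "(\<Sum>i\<le>d. int (f_vector \<Delta> (int i - 1)) * (x - 1) ^ (d - i))
       = (\<Sum>i\<le>d. h_vector \<Delta> i * x ^ (d - i))"
proof -
  have d: "nat (complex_dim \<Delta> + 1) = d"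
    using assms by simp
  have deg: "degree (h_poly \<Delta>) \<le> d"
    unfolding h_poly_def Let_def d
  proof (rule degree_sum_le)
    fix i
    have "degree (of_nat (f_vector \<Delta> (int i - 1)) * [:-1, 1:] ^ (d - i) :: int poly)
        \<le> degree (of_nat (f_vector \<Delta> (int i - 1)) :: int poly) + degree ([:-1, 1:] ^ (d - i) :: int poly)"
      by (rule degree_mult_le)
    also have "\<dots> \<le> d"
      using degree_power_le[of "[:-1, 1:] :: int poly" "d - i"] by simp
    finally show "degree (of_nat (f_vector \<Delta> (int i - 1)) * [:-1, 1:] ^ (d - i) :: int poly) \<le> d" .
  qed simp
  have "(\<Sum>i\<le>d. int (f_vector \<Delta> (int i - 1)) * (x - 1) ^ (d - i)) = poly (h_poly \<Delta>) x"
    unfolding h_poly_def Let_def d by (simp add: poly_sum algebra_simps)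
  also have "\<dots> = (\<Sum>j\<le>d. coeff (h_poly \<Delta>) j * x ^ j)"
    by (subst poly_altdef, rule sum.mono_neutral_left) (use deg in \<open>auto simp: coeff_eq_0\<close>)
  also have "\<dots> = (\<Sum>i\<le>d. h_vector \<Delta> i * x ^ (d - i))"
    unfolding h_vector_def d
    by (rule sum.reindex_bij_witness[of _ "\<lambda>i. d - i" "\<lambda>i. d - i"]) auto
  finally show ?thesis .
qed

text \<open>Vectors \<open>(a\<^sub>1, \<dots>, a\<^sub>n)\<close> of natural numbers are functions on \<^typ>\<open>nat\<close> that
  vanish outside \<open>{1..n}\<close>, so that distinct functions are distinct vectors.\<close>

definition Omega :: "nat \<Rightarrow> nat \<Rightarrow> (nat \<Rightarrow> nat) set" where
  "Omega n r = {a. (\<forall>k. k \<notin> {1..n} \<longrightarrow> a k = 0) \<and> (\<Sum>k=1..n. a k) = r}"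

definition supp :: "(nat \<Rightarrow> nat) \<Rightarrow> nat set" where
  "supp a = {k. a k \<noteq> 0}"

definition iota :: "(nat \<Rightarrow> nat) \<Rightarrow> nat \<Rightarrow> int" where
  "iota a k = (\<Sum>j=1..k. int (a j))"

definition edgewise_subdivision :: "nat \<Rightarrow> nat \<Rightarrow> nat set set \<Rightarrow> (nat \<Rightarrow> nat) set set" where
  "edgewise_subdivision n r \<Delta> = {S. S \<subseteq> Omega n r \<and> (\<Union>a\<in>S. supp a) \<in> \<Delta> \<and>
     (\<forall>a\<in>S. \<forall>a'\<in>S. (\<forall>k\<in>{1..n}. iota a k - iota a' k \<in> {0, 1}) \<or>
                   (\<forall>k\<in>{1..n}. iota a' k - iota a k \<in> {0, 1}))}"

definition h_ratio :: "'a set set \<Rightarrow> nat \<Rightarrow> nat \<Rightarrow> real" where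
  "h_ratio \<Gamma> i j = real_of_int (h_vector \<Gamma> i) / real_of_int (h_vector \<Gamma> j)"

text \<open>Both conditions are about \<open>(d-1)\<close>-dimensional simplicial complexes \<open>\<Gamma>\<close>. All
  denominators in the chains of inequalities are positive.\<close>

definition condition_a :: "nat \<Rightarrow> 'a set set \<Rightarrow> bool" where
  "condition_a d \<Gamma> \<longleftrightarrow> simplicial_complex \<Gamma> \<and> complex_dim \<Gamma> = int d - 1 \<and>
     (\<forall>i\<in>{0..d}. h_vector \<Gamma> i > 0) \<and>
     (\<forall>i\<in>{0..<d}. h_ratio \<Gamma> i (d - i) \<le> h_ratio \<Gamma> (i + 1) (d - (i + 1)))"

definition condition_b :: "nat \<Rightarrow> 'a set set \<Rightarrow> bool" where
  "condition_b d \<Gamma> \<longleftrightarrow> simplicial_complex \<Gamma> \<and> complex_dim \<Gamma> = int d - 1 \<and>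
     (\<forall>i\<in>{1..d - 1}. h_vector \<Gamma> i > 0) \<and> h_vector \<Gamma> d = 0 \<and>
     (\<forall>i\<in>{1..<d - 1}. h_ratio \<Gamma> i (d - i) \<ge> h_ratio \<Gamma> (i + 1) (d - (i + 1)))"

end

theory Submission
  imports Defs "HOL-Library.Multiset" "HOL-Computational_Algebra.Polynomial_FPS"
begin

text \<open>Let \<open>H\<^sub>m\<close> be the number of multisets of size \<open>m\<close> whose underlying set is a face, that is,
  the number of monomials of degree \<open>m\<close> in the Stanley--Reisner ring. For a complex of
  dimension \<open>d - 1\<close> one has \<open>\<Sum>\<^sub>m H\<^sub>m X\<^sup>m = (\<Sum>\<^sub>i h\<^sub>i X\<^sup>i) / (1 - X)\<^sup>d\<close>, so the \<open>h\<close>-vector and the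
  numbers \<open>H\<^sub>m\<close> determine each other (\<open>hilbert_series_numerator\<close>,
  \<open>h_vector_eq_coeff_numerator\<close>).

  The \<open>r\<close>-th edgewise subdivision is a combinatorial form of the \<open>r\<close>-th Veronese construction:
  every multiset of \<open>r m\<close> vertices on a face of \<open>\<Delta>\<close> splits in exactly one way into \<open>m\<close>
  multisets of size \<open>r\<close> that span a face of the subdivision
  (\<open>card_face_multisets_edgewise\<close>). Hence the subdivision has the numbers \<open>H\<^sub>r\<^sub>m\<close> in the place
  of \<open>H\<^sub>m\<close>. Multiplying numerator and denominator of the Hilbert series of \<open>\<Delta>\<close> by
  \<open>(1 + X + \<dots> + X\<^sup>r\<^sup>-\<^sup>1)\<^sup>d\<close> turns the denominator into \<open>(1 - X\<^sup>r)\<^sup>d\<close>, and extracting the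
  exponents divisible by \<open>r\<close> gives \<open>h'\<^sub>i = \<Sum>\<^sub>j c(r i - j) h\<^sub>j\<close>, where \<open>c\<close> is the coefficient
  sequence of \<open>(1 + X + \<dots> + X\<^sup>r\<^sup>-\<^sup>1)\<^sup>d\<close> (\<open>edgewise_h_vector\<close>).

  Both conditions survive the linear map \<open>h \<mapsto> h'\<close> for two reasons. The sequence \<open>c\<close> is
  palindromic, so the map commutes with reversing the vector (\<open>box_transform_reverse\<close>): the
  ratios \<open>h'\<^sub>i / h'\<^sub>d\<^sub>-\<^sub>i\<close> compare the images of \<open>h\<close> and of its reversal. And the
  \<open>2 \<times> 2\<close> minors of the matrix \<open>c(r i - j)\<close> are non-negative
  (\<open>box_count_totally_positive\<close>), so by the Cauchy--Binet formula monotone ratios of two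
  vectors go to monotone ratios of their images (\<open>box_transform_ratio_mono\<close>). In condition (b)
  the bounds that the hypothesis leaves out, those involving \<open>h\<^sub>0\<close> and \<open>h\<^sub>d\<close>, hold because
  \<open>h\<^sub>d = 0\<close> and all the entries are non-negative.\<close>

unbundle fps_syntax

section \<open>The Hilbert series of a simplicial complex\<close>

definition face_multisets :: "'a set set \<Rightarrow> nat \<Rightarrow> 'a multiset set" where
  "face_multisets \<Gamma> m = {M. set_mset M \<in> \<Gamma> \<and> size M = m}"

definition hilbert_series :: "'a set set \<Rightarrow> int fps" where
  "hilbert_series \<Gamma> = Abs_fps (\<lambda>m. int (card (face_multisets \<Gamma> m)))"

lemma hilbert_series_nth [simp]:
  "hilbert_series \<Gamma> $ m = int (card (face_multisets \<Gamma> m))"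
  by (simp add: hilbert_series_def)

lemma finite_face_multisets:
  assumes "finite F"
  shows "finite (face_multisets {F} m)"
proof (rule finite_subset)
  show "face_multisets {F} m \<subseteq> multisets_of_size F m"
    by (auto simp: face_multisets_def multisets_of_size_def)
  show "finite (multisets_of_size F m)"
    using assms by blast
qed

text \<open>Removing one copy of \<open>x\<close> from a multiset with support \<open>F \<union> {x}\<close> leaves support \<open>F \<union> {x}\<close> or
  \<open>F\<close>. So each vertex multiplies the series by \<open>X / (1 - X)\<close>, here with the denominator cleared.\<close>

lemma hilbert_series_singleton:
  assumes "finite F"
  shows "(1 - fps_X) ^ card F * hilbert_series {F} = fps_X ^ card F"
  using assms
proof (induction F rule: finite_induct)
  case empty
  have "card (face_multisets {{} :: 'a set} m) = (if m = 0 then 1 else 0)" for m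
  proof -
    have "face_multisets {{}} m = (if m = 0 then {{#} :: 'a multiset} else {})"
      by (auto simp: face_multisets_def)
    then show ?thesis by (cases "m = 0") simp_all
  qed
  then show ?case
    by (simp add: fps_eq_iff)
next
  case (insert x F)
  let ?G = "insert x F"
  have split: "face_multisets {?G} (Suc m) =
      add_mset x ` (face_multisets {?G} m \<union> face_multisets {F} m)" (is "?L = ?R") for m
  proof
    show "?L \<subseteq> ?R"
    proof
      fix M assume M: "M \<in> ?L"
      then have "x \<in># M" by (auto simp: face_multisets_def)
      then obtain N where N: "M = add_mset x N" by (meson mset_add)
      with M have "insert x (set_mset N) = insert x F" "size N = m"
        by (auto simp: face_multisets_def)
      with \<open>x \<notin> F\<close> have "N \<in> face_multisets {?G} m \<union> face_multisets {F} m"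
        by (cases "x \<in># N") (auto simp: face_multisets_def)
      with N show "M \<in> ?R" by blast
    qed
    show "?R \<subseteq> ?L"
    proof
      fix M assume "M \<in> ?R"
      then obtain N where "M = add_mset x N" "set_mset N = ?G \<or> set_mset N = F" "size N = m"
        by (fastforce simp: face_multisets_def)
      then show "M \<in> ?L" by (auto simp: face_multisets_def)
    qed
  qed
  have "card (face_multisets {?G} (Suc m)) =
      card (face_multisets {?G} m) + card (face_multisets {F} m)" for m
  proof -
    have "card (add_mset x ` (face_multisets {?G} m \<union> face_multisets {F} m))
        = card (face_multisets {?G} m \<union> face_multisets {F} m)"
      by (intro card_image) (simp add: inj_on_def)
    also have "\<dots> = card (face_multisets {?G} m) + card (face_multisets {F} m)"
    proof (rule card_Un_disjoint)
      show "face_multisets {?G} m \<inter> face_multisets {F} m = {}"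
        using \<open>x \<notin> F\<close> by (auto simp: face_multisets_def)
    qed (use \<open>finite F\<close> in \<open>simp_all add: finite_face_multisets\<close>)
    finally show ?thesis by (simp only: split)
  qed
  moreover have "face_multisets {?G} 0 = {}"
    by (auto simp: face_multisets_def)
  ultimately have "hilbert_series {?G} $ m - (fps_X * hilbert_series {?G}) $ m
      = (fps_X * hilbert_series {F}) $ m" for m
    by (cases m) simp_all
  then have step: "(1 - fps_X) * hilbert_series {?G} = fps_X * hilbert_series {F}"
    by (simp add: fps_eq_iff left_diff_distrib)
  have "(1 - fps_X) ^ card ?G * hilbert_series {?G}
      = (1 - fps_X) ^ card F * ((1 - fps_X) * hilbert_series {?G})"
    using insert.hyps by (simp add: mult_ac)
  also have "\<dots> = fps_X * ((1 - fps_X) ^ card F * hilbert_series {F})"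
    unfolding step by (simp only: mult_ac)
  finally show ?case
    using insert by simp
qed

text \<open>The numerator \<open>\<Sum>\<^sub>F X\<^bsup>|F|\<^esup> (1 - X)\<^bsup>d - |F|\<^esup>\<close> of the Hilbert series over \<open>(1 - X)\<^sup>d\<close>. The
  parameter \<open>d\<close> is free, so that the dimension of a complex can be read off from its series
  instead of having to be known in advance.\<close>

definition h_numerator :: "nat \<Rightarrow> 'a set set \<Rightarrow> int poly" where
  "h_numerator d \<Gamma> = (\<Sum>F\<in>\<Gamma>. [:0, 1:] ^ card F * [:1, -1:] ^ (d - card F))"

lemma hilbert_series_eq_sum:
  assumes "simplicial_complex \<Gamma>"
  shows "hilbert_series \<Gamma> = (\<Sum>F\<in>\<Gamma>. hilbert_series {F})"
proof (rule fps_ext)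
  fix m
  have "face_multisets \<Gamma> m = (\<Union>F\<in>\<Gamma>. face_multisets {F} m)"
    by (auto simp: face_multisets_def)
  moreover have "card (\<Union>F\<in>\<Gamma>. face_multisets {F} m) = (\<Sum>F\<in>\<Gamma>. card (face_multisets {F} m))"
    using assms by (intro card_UN_disjoint ballI finite_face_multisets)
      (auto simp: simplicial_complex_def face_multisets_def)
  ultimately show "hilbert_series \<Gamma> $ m = (\<Sum>F\<in>\<Gamma>. hilbert_series {F}) $ m"
    by (simp add: fps_sum_nth)
qed

lemma fps_of_poly_one_minus_X: "fps_of_poly [:1, -1:] = (1 - fps_X :: int fps)"
  by (simp add: fps_of_poly_pCons)

lemma hilbert_series_numerator:
  assumes "simplicial_complex \<Gamma>" and "\<And>F. F \<in> \<Gamma> \<Longrightarrow> card F \<le> d"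
  shows "(1 - fps_X) ^ d * hilbert_series \<Gamma> = fps_of_poly (h_numerator d \<Gamma>)"
proof -
  have "(1 - fps_X) ^ d * hilbert_series {F}
      = fps_of_poly ([:0, 1:] ^ card F * [:1, -1:] ^ (d - card F))" if "F \<in> \<Gamma>" for F
  proof -
    have "finite F" using assms(1) that by (auto simp: simplicial_complex_def)
    have "(1 - fps_X :: int fps) ^ d = (1 - fps_X) ^ (d - card F) * (1 - fps_X) ^ card F"
      using assms(2)[OF that] by (simp flip: power_add)
    then have "(1 - fps_X) ^ d * hilbert_series {F}
        = (1 - fps_X) ^ (d - card F) * ((1 - fps_X) ^ card F * hilbert_series {F})"
      by (simp only: mult_ac)
    also have "\<dots> = fps_X ^ card F * (1 - fps_X) ^ (d - card F)"
      using hilbert_series_singleton[OF \<open>finite F\<close>] by (simp only: mult_ac)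
    finally show ?thesis
      by (simp only: fps_of_poly_mult fps_of_poly_power fps_of_poly_one_minus_X fps_of_poly_fps_X)
  qed
  then show ?thesis
    by (simp add: hilbert_series_eq_sum[OF assms(1)] sum_distrib_left h_numerator_def fps_of_poly_sum)
qed

lemma degree_h_numerator:
  assumes "finite \<Gamma>" "\<And>F. F \<in> \<Gamma> \<Longrightarrow> card F \<le> d"
  shows "degree (h_numerator d \<Gamma>) \<le> d"
  unfolding h_numerator_def
proof (rule degree_sum_le)
  fix F assume "F \<in> \<Gamma>"
  have "degree ([:0, 1:] ^ card F * [:1, -1:] ^ (d - card F) :: int poly)
      \<le> degree ([:0, 1:] ^ card F :: int poly) + degree ([:1, -1:] ^ (d - card F) :: int poly)"
    by (rule degree_mult_le)
  also have "\<dots> \<le> card F + (d - card F)"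
    using degree_power_le[of "[:0, 1 :: int:]" "card F"] degree_power_le[of "[:1, -1 :: int:]" "d - card F"]
    by (intro add_mono) auto
  finally show "degree ([:0, 1:] ^ card F * [:1, -1:] ^ (d - card F) :: int poly) \<le> d"
    using assms(2)[OF \<open>F \<in> \<Gamma>\<close>] by simp
qed (rule assms)

lemma card_le_dim:
  assumes "simplicial_complex \<Gamma>" "complex_dim \<Gamma> = int d - 1" "F \<in> \<Gamma>"
  shows "card F \<le> d"
proof -
  have "face_dim F \<le> complex_dim \<Gamma>"
    unfolding complex_dim_def using assms by (intro Max_ge) (auto simp: simplicial_complex_def)
  then show ?thesis using assms(2) by (simp add: face_dim_def)
qed

text \<open>The \<open>h\<close>-polynomial collects terms \<open>(x - 1)\<^bsup>d - k\<^esup>\<close> and the numerator of the Hilbert series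
  terms \<open>X\<^sup>k (1 - X)\<^bsup>d - k\<^esup>\<close>; each is the other with its coefficients read backwards.\<close>

lemma coeff_reversed_linear_power:
  assumes "k \<le> d" "i \<le> d"
  shows "coeff ([:-1, 1:] ^ (d - k)) (d - i) = coeff ([:0, 1:] ^ k * [:1, -1:] ^ (d - k) :: int poly) i"
proof -
  have X: "[:0, 1:] ^ k = monom (1::int) k" by (simp add: monom_altdef)
  show ?thesis
  proof (cases "k \<le> i")
    case True
    then obtain j where j: "i = k + j" using le_Suc_ex by blast
    then obtain e where e: "d = k + j + e" using assms(2) le_Suc_ex by blast
    have "(j + e) choose e = (j + e) choose j"
      using binomial_symmetric[of j "j + e"] by simp
    then show ?thesis
      by (simp add: j e X coeff_monom_mult coeff_linear_poly_power)
  next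
    case False
    then have "d - k < d - i" using assms by simp
    then have "coeff ([:-1, 1:] ^ (d - k)) (d - i) = (0::int)"
      by (intro coeff_eq_0) (simp add: degree_linear_power)
    then show ?thesis using False by (simp add: X coeff_monom_mult)
  qed
qed

lemma h_vector_eq_coeff_numerator:
  assumes "simplicial_complex \<Gamma>" "complex_dim \<Gamma> = int d - 1" "i \<le> d"
  shows "h_vector \<Gamma> i = coeff (h_numerator d \<Gamma>) i"
proof -
  have d: "nat (complex_dim \<Gamma> + 1) = d" using assms by simp
  have fin: "finite \<Gamma>" using assms by (auto simp: simplicial_complex_def)
  have "h_poly \<Gamma> = (\<Sum>k\<le>d. \<Sum>F | F \<in> \<Gamma> \<and> card F = k. [:-1, 1:] ^ (d - card F))"
    unfolding h_poly_def Let_def d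
    by (intro sum.cong refl) (auto simp: f_vector_def face_dim_def)
  also have "\<dots> = (\<Sum>F\<in>\<Gamma>. [:-1, 1:] ^ (d - card F))"
    using fin card_le_dim[OF assms(1,2)] by (intro sum.group) auto
  finally have "h_vector \<Gamma> i = (\<Sum>F\<in>\<Gamma>. coeff ([:-1, 1:] ^ (d - card F)) (d - i))"
    by (simp add: h_vector_def d coeff_sum)
  also have "\<dots> = coeff (h_numerator d \<Gamma>) i"
    unfolding h_numerator_def coeff_sum
    using card_le_dim[OF assms(1,2)] assms(3)
    by (intro sum.cong refl coeff_reversed_linear_power) auto
  finally show ?thesis .
qed

lemma h_vector_0:
  assumes "simplicial_complex \<Gamma>" "complex_dim \<Gamma> = int d - 1"
  shows "h_vector \<Gamma> 0 = 1"
proof -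
  have "face_multisets \<Gamma> 0 = {{#}}"
    using assms(1) by (auto simp: face_multisets_def simplicial_complex_def)
  moreover have "(1 - fps_X :: int fps) ^ d $ 0 = 1"
    by (simp add: fps_power_zeroth)
  ultimately have "((1 - fps_X) ^ d * hilbert_series \<Gamma>) $ 0 = 1"
    by simp
  then show ?thesis
    using hilbert_series_numerator[OF assms(1) card_le_dim[OF assms]]
      h_vector_eq_coeff_numerator[OF assms, of 0] by simp
qed

text \<open>The dimension is one less than the order of the pole of the Hilbert series at \<open>1\<close>: over
  \<open>(1 - X)\<^sup>D\<close>, with \<open>D\<close> the largest size of a face, the numerator takes at \<open>1\<close> the number of
  faces of size \<open>D\<close>, which is not \<open>0\<close>. Two numerators that do not vanish at \<open>1\<close> belong to the
  same power of \<open>1 - X\<close>.\<close>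

lemma complex_dim_eqI:
  assumes \<Gamma>: "simplicial_complex \<Gamma>"
    and p: "(1 - fps_X) ^ d * hilbert_series \<Gamma> = fps_of_poly p" "poly p 1 \<noteq> 0"
  shows "complex_dim \<Gamma> = int d - 1"
proof -
  have fin: "finite \<Gamma>" and ne: "{} \<in> \<Gamma>" using \<Gamma> by (auto simp: simplicial_complex_def)
  define D where "D = Max (card ` \<Gamma>)"
  have le: "card F \<le> D" if "F \<in> \<Gamma>" for F using fin that by (auto simp: D_def)
  have "D \<in> card ` \<Gamma>" unfolding D_def using fin ne by (intro Max_in) auto
  then obtain F where F: "F \<in> \<Gamma>" "card F = D" by auto
  have "complex_dim \<Gamma> = face_dim F"
    unfolding complex_dim_def
  proof (intro Max_eqI)
    fix y assume "y \<in> face_dim ` \<Gamma>"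
    then obtain G where "G \<in> \<Gamma>" "y = int (card G) - 1" by (auto simp: face_dim_def)
    moreover from this have "int (card G) \<le> int (card F)" using F le by simp
    ultimately show "y \<le> face_dim F" by (simp add: face_dim_def)
  qed (use fin F in auto)
  then have dim: "complex_dim \<Gamma> = int D - 1" using F by (simp add: face_dim_def)
  define q where "q = h_numerator D \<Gamma>"
  have "poly q 1 = (\<Sum>G\<in>\<Gamma>. 0 ^ (D - card G))"
    by (simp add: q_def h_numerator_def poly_sum)
  also have "\<dots> = (\<Sum>G\<in>{G\<in>\<Gamma>. card G = D}. 1)"
    using fin le by (subst sum.inter_filter) (auto intro!: sum.cong simp: power_0_left dest: le)
  finally have q1: "poly q 1 \<noteq> 0" using F fin by auto
  have q: "(1 - fps_X) ^ D * hilbert_series \<Gamma> = fps_of_poly q"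
    unfolding q_def by (rule hilbert_series_numerator[OF \<Gamma> le])
  have "fps_of_poly ([:1, -1:] ^ d * q) = fps_of_poly ([:1, -1:] ^ D * p)"
    by (simp only: fps_of_poly_mult fps_of_poly_power fps_of_poly_one_minus_X flip: p(1) q)
       (simp only: mult_ac)
  then have pq: "[:1, -1:] ^ d * q = [:1, -1:] ^ D * p"
    by (simp only: fps_of_poly_eq_iff)
  \<comment> \<open>With different exponents, cancelling the common power of \<open>1 - X\<close> leaves a factor that vanishes at \<open>1\<close>.\<close>
  have "D = d"
  proof (rule ccontr)
    assume "D \<noteq> d"
    then consider "d < D" | "D < d" by linarith
    then show False
    proof cases
      case 1
      then have "[:1, -1:] ^ D = [:1, -1 :: int:] ^ d * [:1, -1:] ^ (D - d)"
        by (simp flip: power_add)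
      with pq have "q = [:1, -1:] ^ (D - d) * p" by (simp add: mult.assoc)
      then have "poly q 1 = 0" using 1 by simp
      with q1 show False by simp
    next
      case 2
      then have "[:1, -1:] ^ d = [:1, -1 :: int:] ^ D * [:1, -1:] ^ (d - D)"
        by (simp flip: power_add)
      with pq have "[:1, -1:] ^ (d - D) * q = p" by (simp add: mult.assoc)
      then have "poly p 1 = 0" using 2 by auto
      with p show False by simp
    qed
  qed
  with dim show ?thesis by simp
qed

section \<open>Splitting multisets along the edgewise subdivision\<close>

lemma iota_0 [simp]: "iota a 0 = 0"
  by (simp add: iota_def)

lemma iota_Suc [simp]: "iota a (Suc k) = iota a k + int (a (Suc k))"
  by (simp add: iota_def)

lemma iota_nonneg: "0 \<le> iota a k"
  by (simp add: iota_def sum_nonneg)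

lemma iota_inject:
  assumes "\<And>k. iota a k = iota b k" "a 0 = b 0"
  shows "a = b"
proof
  fix k show "a k = b k"
    using assms(2) assms(1)[of k] assms(1)[of "k - 1"] by (cases k) auto
qed

lemma iota_outside:
  assumes "\<And>k. n < k \<Longrightarrow> a k = 0" "n \<le> k"
  shows "iota a k = iota a n"
  using assms(2) by (induction k rule: dec_induct) (auto simp: assms(1))

lemma iota_Omega: "a \<in> Omega n r \<Longrightarrow> n \<le> k \<Longrightarrow> iota a k = int r"
  by (subst iota_outside[of n]) (auto simp: Omega_def iota_def simp flip: of_nat_sum)

lemma iota_Omega_outside:
  assumes "a \<in> Omega n r" "b \<in> Omega n r" "k \<notin> {1..n}"
  shows "iota a k = iota b k"
  using assms by (cases "k = 0") (auto simp: iota_Omega)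

text \<open>A weakly increasing sequence of \<open>m\<close> integers that varies by at most one is determined by its
  sum. Together with \<open>sum_shifted_div\<close> this yields the unique splitting of a multiset: at each
  position \<open>k\<close> the values \<open>iota a k\<close>, for \<open>a\<close> in a chain, form such a sequence.\<close>

lemma balanced_sequence:
  fixes y :: "nat \<Rightarrow> int"
  assumes y: "\<And>i j. i \<le> j \<Longrightarrow> j < m \<Longrightarrow> y i \<le> y j \<and> y j \<le> y i + 1" and l: "l < m"
  shows "y l = ((\<Sum>i<m. y i) + int l) div int m"
proof -
  \<comment> \<open>The terms before \<open>l\<close> lie in \<open>{y l - 1, y l}\<close> and those after \<open>l\<close> in \<open>{y l, y l + 1}\<close>,
    which confines the sum plus \<open>l\<close> to \<open>[m (y l), m (y l + 1))\<close>.\<close>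
  have split: "(\<Sum>i<m. g i) = (\<Sum>i<l. g i) + g l + (\<Sum>i=Suc l..<m. g i)" for g :: "nat \<Rightarrow> int"
  proof -
    have "{..<m} = {..<l} \<union> {l..<m}" using l by auto
    then have "(\<Sum>i<m. g i) = (\<Sum>i<l. g i) + (\<Sum>i=l..<m. g i)"
      by (simp add: sum.union_disjoint ivl_disj_int)
    then show ?thesis
      using l by (simp add: sum.atLeast_Suc_lessThan)
  qed
  have before: "y i \<le> y l" "y l - 1 \<le> y i" if "i < l" for i
    using y[of i l] l that by auto
  have after: "y l \<le> y i" "y i \<le> y l + 1" if "l < i" "i < m" for i
    using y[of l i] that by auto
  have "(\<Sum>i<l. y l - 1) \<le> (\<Sum>i<l. y i)" "(\<Sum>i=Suc l..<m. y l) \<le> (\<Sum>i=Suc l..<m. y i)"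
    by (intro sum_mono; simp add: before after)+
  then have "int l * (y l - 1) + y l + int (m - Suc l) * y l \<le> (\<Sum>i<m. y i)"
    unfolding split by simp
  moreover have "(\<Sum>i<l. y i) \<le> (\<Sum>i<l. y l)" "(\<Sum>i=Suc l..<m. y i) \<le> (\<Sum>i=Suc l..<m. y l + 1)"
    by (intro sum_mono; simp add: before after)+
  then have "(\<Sum>i<m. y i) \<le> int l * y l + y l + int (m - Suc l) * (y l + 1)"
    unfolding split by simp
  ultimately have "int m * y l \<le> (\<Sum>i<m. y i) + int l" "(\<Sum>i<m. y i) + int l < int m * (y l + 1)"
    using l by (simp_all add: of_nat_diff algebra_simps)
  then show ?thesis
    using int_div_pos_eq[of "(\<Sum>i<m. y i) + int l" "int m" "y l" "(\<Sum>i<m. y i) + int l - int m * y l"]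
    by (simp add: algebra_simps)
qed

text \<open>Raising \<open>S\<close> by one shifts the summands by one place: the term \<open>S div m\<close> leaves and
  \<open>(S + m) div m\<close>, which is larger by one, enters.\<close>

lemma sum_shifted_div:
  assumes "m > 0"
  shows "(\<Sum>l<m. (int S + int l) div int m) = int S"
proof (induction S)
  case 0
  have "(\<Sum>l<m. int l div int m) = 0" by (intro sum.neutral) simp
  then show ?case by simp
next
  case (Suc S)
  have "(\<Sum>l<m. (int (Suc S) + int l) div int m) = (\<Sum>l<m. (int S + int (Suc l)) div int m)"
    by (simp add: add_ac)
  also have "\<dots> = (\<Sum>l<Suc m. (int S + int l) div int m) - int S div int m"
    by (subst sum.lessThan_Suc_shift) simp
  also have "\<dots> = int S + (int S + int m) div int m - int S div int m"
    using Suc by simp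
  also have "\<dots> = int (Suc S)"
    using assms by simp
  finally show ?case .
qed

text \<open>A vector \<open>a\<close> with non-negative entries is the multiset containing \<open>k\<close> with multiplicity
  \<open>a k\<close>, and \<open>pool\<close> adds up the multisets \<open>a\<close> in \<open>M\<close>. Conversely \<open>dealt m N\<close> lists \<open>N\<close> in
  increasing order and hands it out cyclically to the recipients \<open>m - 1, \<dots>, 0\<close>, as when
  dealing cards.
  In terms of partial sums, the number of elements up to \<open>k\<close> that recipient \<open>l\<close> gets is
  \<open>(iota (count N) k + l) div m\<close>; the entries of \<open>deal m N l\<close> are the differences of these
  numbers.\<close>

definition pool :: "(nat \<Rightarrow> nat) multiset \<Rightarrow> nat multiset" where
  "pool M = Abs_multiset (\<lambda>k. \<Sum>a\<in>#M. a k)"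

definition deal :: "nat \<Rightarrow> nat multiset \<Rightarrow> nat \<Rightarrow> nat \<Rightarrow> nat" where
  "deal m N l k = nat ((iota (count N) k + int l) div int m - (iota (count N) (k - 1) + int l) div int m)"

definition dealt :: "nat \<Rightarrow> nat multiset \<Rightarrow> (nat \<Rightarrow> nat) multiset" where
  "dealt m N = image_mset (deal m N) (mset [0..<m])"

lemma count_pool:
  assumes "set_mset M \<subseteq> Omega n r"
  shows "count (pool M) k = (\<Sum>a\<in>#M. a k)"
proof -
  have "(\<Sum>a\<in>#M. a k) = 0" if "k \<notin> {1..n}" for k
    using assms that by (auto simp: Omega_def)
  then have "{k. 0 < (\<Sum>a\<in>#M. a k)} \<subseteq> {1..n}"
    by (metis (mono_tags, lifting) less_irrefl mem_Collect_eq subsetI)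
  then have "finite {k. 0 < (\<Sum>a\<in>#M. a k)}"
    using finite_subset by blast
  then show ?thesis
    by (simp add: pool_def count_Abs_multiset)
qed

lemma iota_pool:
  assumes "set_mset M \<subseteq> Omega n r"
  shows "iota (count (pool M)) k = (\<Sum>a\<in>#M. iota a k)"
proof -
  have "(\<Sum>j=1..k. int (\<Sum>a\<in>#M. a j)) = (\<Sum>a\<in>#M. iota a k)"
    by (induction M) (auto simp: iota_def sum.distrib)
  then show ?thesis by (simp add: iota_def count_pool[OF assms])
qed

lemma set_mset_pool:
  assumes "set_mset M \<subseteq> Omega n r"
  shows "set_mset (pool M) = (\<Union>a\<in>set_mset M. supp a)"
proof -
  have "(\<Sum>a\<in>#M. a k) \<noteq> 0 \<longleftrightarrow> (\<exists>a\<in>#M. a k \<noteq> 0)" for k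
    by (induction M) auto
  then have "k \<in># pool M \<longleftrightarrow> (\<exists>a\<in>#M. k \<in> supp a)" for k
    using count_pool[OF assms, of k] count_eq_zero_iff[of "pool M" k] by (auto simp: supp_def)
  then show ?thesis by auto
qed

lemma iota_count_eq_size:
  assumes "set_mset N \<subseteq> {1..n}"
  shows "iota (count N) n = int (size N)"
proof -
  have "size N = (\<Sum>k=1..n. count N k)"
    unfolding size_multiset_overloaded_eq
    using assms by (intro sum.mono_neutral_left) (auto simp: not_in_iff)
  then show ?thesis by (simp add: iota_def)
qed

lemma iota_deal:
  assumes "l < m"
  shows "iota (deal m N l) k = (iota (count N) k + int l) div int m"
proof (induction k)
  case 0
  then show ?case using assms by simp
next
  case (Suc k)
  have "(iota (count N) k + int l) div int m \<le> (iota (count N) (Suc k) + int l) div int m"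
    using assms by (intro zdiv_mono1) auto
  with Suc show ?case by (simp add: deal_def)
qed

lemma set_mset_dealt: "set_mset (dealt m N) = deal m N ` {..<m}"
  by (auto simp: dealt_def)

lemma size_dealt [simp]: "size (dealt m N) = m"
  by (simp add: dealt_def)

lemma deal_in_Omega:
  assumes "set_mset N \<subseteq> {1..n}" "size N = r * m" "l < m"
  shows "deal m N l \<in> Omega n r"
proof -
  have "deal m N l k = 0" if "k \<notin> {1..n}" for k
  proof (cases "k = 0")
    case False
    then have "iota (count N) k = iota (count N) n" "iota (count N) (k - 1) = iota (count N) n"
      using assms(1) that by (auto intro!: iota_outside simp: not_in_iff[symmetric])
    then show ?thesis by (simp add: deal_def)
  qed (simp add: deal_def)
  moreover have "iota (deal m N l) n = int r"
    using assms by (simp add: iota_deal iota_count_eq_size)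
  ultimately show ?thesis
    unfolding Omega_def iota_def by (simp flip: of_nat_sum)
qed

lemma pool_dealt:
  assumes "set_mset N \<subseteq> {1..n}" "size N = r * m" "r \<ge> 1"
  shows "pool (dealt m N) = N"
proof (cases "m = 0")
  case True
  then show ?thesis using assms by (simp add: dealt_def pool_def Abs_multiset_inverse multiset_eq_iff count_Abs_multiset)
next
  case False
  have sub: "set_mset (dealt m N) \<subseteq> Omega n r"
    using deal_in_Omega[OF assms(1,2)] by (auto simp: set_mset_dealt)
  have "iota (count (pool (dealt m N))) k = iota (count N) k" for k
  proof -
    have "iota (count (pool (dealt m N))) k = (\<Sum>l<m. iota (deal m N l) k)"
      unfolding iota_pool[OF sub]
      by (simp add: dealt_def image_mset.compositionality comp_def sum_unfold_sum_mset
          atLeast0LessThan)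
    also have "\<dots> = (\<Sum>l<m. (int (nat (iota (count N) k)) + int l) div int m)"
      by (simp add: iota_deal iota_nonneg)
    also have "\<dots> = iota (count N) k"
      using False iota_nonneg[of "count N" k] by (subst sum_shifted_div) auto
    finally show ?thesis .
  qed
  moreover have "count (pool (dealt m N)) 0 = count N 0"
  proof -
    have "0 \<notin># N" "0 \<notin># pool (dealt m N)"
      using assms(1) sub unfolding set_mset_pool[OF sub] by (auto simp: supp_def Omega_def)
    then show ?thesis by (simp add: not_in_iff)
  qed
  ultimately have "count (pool (dealt m N)) = count N"
    by (rule iota_inject)
  then show ?thesis by (simp add: count_inject)
qed

lemma edgewise_chain:
  assumes "S \<in> edgewise_subdivision n r \<Delta>" "a \<in> S" "b \<in> S"
  shows "(\<forall>k. iota a k \<le> iota b k \<and> iota b k \<le> iota a k + 1) \<or>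
         (\<forall>k. iota b k \<le> iota a k \<and> iota a k \<le> iota b k + 1)"
proof -
  have "S \<subseteq> Omega n r" using assms by (auto simp: edgewise_subdivision_def)
  then have out: "iota a k = iota b k" if "k \<notin> {1..n}" for k
    using assms that by (intro iota_Omega_outside[of _ n r]) auto
  have "(\<forall>k\<in>{1..n}. iota a k - iota b k \<in> {0, 1}) \<or> (\<forall>k\<in>{1..n}. iota b k - iota a k \<in> {0, 1})"
    using assms by (auto simp: edgewise_subdivision_def)
  then show ?thesis
  proof
    assume *: "\<forall>k\<in>{1..n}. iota a k - iota b k \<in> {0, 1}"
    have "iota b k \<le> iota a k \<and> iota a k \<le> iota b k + 1" for k
      using *[rule_format, of k] out[of k] by (cases "k \<in> {1..n}") auto
    then show ?thesis by blast
  next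
    assume *: "\<forall>k\<in>{1..n}. iota b k - iota a k \<in> {0, 1}"
    have "iota a k \<le> iota b k \<and> iota b k \<le> iota a k + 1" for k
      using *[rule_format, of k] out[of k] by (cases "k \<in> {1..n}") auto
    then show ?thesis by blast
  qed
qed

text \<open>Uniqueness of the splitting. The vectors of \<open>M\<close> are listed in increasing order of \<open>iota\<close>; on
  a chain this can be done by sorting along the sum of the entries of \<open>iota\<close>. For every
  \<open>k\<close> the values \<open>iota a k\<close> then form a balanced sequence whose sum is given by \<open>pool M\<close>.\<close>

lemma dealt_pool:
  assumes S: "set_mset M \<in> edgewise_subdivision n r \<Delta>" and m: "size M = m"
  shows "dealt m (pool M) = M"
proof -
  have sub: "set_mset M \<subseteq> Omega n r" using S by (auto simp: edgewise_subdivision_def)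
  obtain ys where ys: "mset ys = M" using ex_mset by blast
  define key where "key a = (\<Sum>k=1..n. iota a k)" for a
  define xs where "xs = sort_key key ys"
  have xs: "mset xs = M" "sorted (map key xs)" "length xs = m"
    using ys m by (auto simp: xs_def)
  \<comment> \<open>Vectors with equal keys that are comparable coincide in \<open>iota\<close>, so that sorting by the
    key cannot place two vectors against the order of the chain.\<close>
  have eq_key: "iota a k = iota b k" if "\<forall>k. iota a k \<le> iota b k" "key b \<le> key a"
      "a \<in># M" "b \<in># M" for a b k
  proof (cases "k \<in> {1..n}")
    case True
    have "key a = key b"
      using that sum_mono[of "{1..n}" "iota a" "iota b"] by (auto simp: key_def)
    show ?thesis
    proof (rule ccontr)
      assume "iota a k \<noteq> iota b k"
      then have "iota a k < iota b k" using that(1) by (simp add: order_less_le)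
      then have "key a < key b"
        unfolding key_def using True that(1) by (intro sum_strict_mono_ex1) auto
      with \<open>key a = key b\<close> show False by simp
    qed
  next
    case False
    then show ?thesis
      using that sub by (intro iota_Omega_outside[of _ n r]) auto
  qed
  have bal: "iota (xs ! i) k \<le> iota (xs ! j) k \<and> iota (xs ! j) k \<le> iota (xs ! i) k + 1"
    if "i \<le> j" "j < m" for i j k
  proof -
    have key: "key (xs ! i) \<le> key (xs ! j)"
      using sorted_nth_mono[OF xs(2)] that xs(3) by simp
    have mem: "xs ! i \<in># M" "xs ! j \<in># M"
      using that xs by (auto simp flip: xs(1))
    from edgewise_chain[OF S mem] show ?thesis
    proof
      assume "\<forall>k. iota (xs ! j) k \<le> iota (xs ! i) k \<and> iota (xs ! i) k \<le> iota (xs ! j) k + 1"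
      then have "iota (xs ! j) k = iota (xs ! i) k"
        using eq_key[OF _ key mem(2,1)] by blast
      then show ?thesis by simp
    qed blast
  qed
  have "deal m (pool M) l = xs ! l" if "l < m" for l
  proof (rule iota_inject)
    fix k
    have "iota (count (pool M)) k = (\<Sum>i<m. iota (xs ! i) k)"
      using iota_pool[OF sub, of k]
      by (simp add: sum_mset_sum_list sum_list_sum_nth xs(3) atLeast0LessThan flip: xs(1) mset_map)
    then show "iota (deal m (pool M) l) k = iota (xs ! l) k"
      using balanced_sequence[of m "\<lambda>i. iota (xs ! i) k" l] bal that by (simp add: iota_deal)
  next
    have "xs ! l \<in># M" using that xs by (auto simp flip: xs(1))
    then show "deal m (pool M) l 0 = (xs ! l) 0"
      using sub by (auto simp: deal_def Omega_def)
  qed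
  then have "map (deal m (pool M)) [0..<m] = xs"
    using xs(3) by (intro nth_equalityI) auto
  then have "mset (map (deal m (pool M)) [0..<m]) = M"
    using xs(1) by simp
  then show ?thesis
    by (simp only: dealt_def mset_map)
qed

lemma set_mset_dealt_in_edgewise:
  assumes "set_mset N \<in> \<Delta>" "set_mset N \<subseteq> {1..n}" "size N = r * m" "r \<ge> 1"
  shows "set_mset (dealt m N) \<in> edgewise_subdivision n r \<Delta>"
proof -
  have sub: "set_mset (dealt m N) \<subseteq> Omega n r"
    using deal_in_Omega[OF assms(2,3)] by (auto simp: set_mset_dealt)
  have step: "iota (deal m N j) k - iota (deal m N i) k \<in> {0, 1}" if "i \<le> j" "j < m" for i j k
  proof -
    let ?s = "iota (count N) k"
    have "(?s + int i) div int m \<le> (?s + int j) div int m"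
      using that by (intro zdiv_mono1) auto
    moreover have "(?s + int j) div int m \<le> (?s + int i + int m) div int m"
      using that by (intro zdiv_mono1) auto
    ultimately show ?thesis
      using that by (auto simp: iota_deal)
  qed
  have "(\<Union>a\<in>set_mset (dealt m N). supp a) \<in> \<Delta>"
    using set_mset_pool[OF sub] pool_dealt[OF assms(2-4)] assms(1) by simp
  moreover have "(\<forall>k\<in>{1..n}. iota (deal m N i) k - iota (deal m N j) k \<in> {0, 1}) \<or>
      (\<forall>k\<in>{1..n}. iota (deal m N j) k - iota (deal m N i) k \<in> {0, 1})" if "i < m" "j < m" for i j
    using step[of i j] step[of j i] that by (cases "i \<le> j") auto
  then have "\<forall>a\<in>set_mset (dealt m N). \<forall>b\<in>set_mset (dealt m N).
      (\<forall>k\<in>{1..n}. iota a k - iota b k \<in> {0, 1}) \<or> (\<forall>k\<in>{1..n}. iota b k - iota a k \<in> {0, 1})"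
    unfolding set_mset_dealt by simp
  ultimately show ?thesis
    using sub unfolding edgewise_subdivision_def mem_Collect_eq by (intro conjI)
qed

text \<open>The Hilbert function of the subdivision at \<open>m\<close> is that of \<open>\<Delta>\<close> at \<open>r m\<close>, exactly as for the
  \<open>r\<close>-th Veronese subring: pooling and dealing are inverse to each other.\<close>

lemma card_face_multisets_edgewise:
  assumes "\<Union>\<Delta> \<subseteq> {1..n}" "r \<ge> 1"
  shows "card (face_multisets (edgewise_subdivision n r \<Delta>) m) = card (face_multisets \<Delta> (r * m))"
proof (rule bij_betw_same_card)
  show "bij_betw pool (face_multisets (edgewise_subdivision n r \<Delta>) m) (face_multisets \<Delta> (r * m))"
  proof (rule bij_betw_byWitness[where f' = "dealt m"])
    show "\<forall>M\<in>face_multisets (edgewise_subdivision n r \<Delta>) m. dealt m (pool M) = M"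
      by (auto simp: face_multisets_def intro!: dealt_pool)
    show "\<forall>N\<in>face_multisets \<Delta> (r * m). pool (dealt m N) = N"
      using assms by (auto simp: face_multisets_def intro!: pool_dealt[of _ n])
    show "dealt m ` face_multisets \<Delta> (r * m) \<subseteq> face_multisets (edgewise_subdivision n r \<Delta>) m"
      using assms by (auto simp: face_multisets_def intro!: set_mset_dealt_in_edgewise)
    show "pool ` face_multisets (edgewise_subdivision n r \<Delta>) m \<subseteq> face_multisets \<Delta> (r * m)"
    proof safe
      fix M assume M: "M \<in> face_multisets (edgewise_subdivision n r \<Delta>) m"
      then have sub: "set_mset M \<subseteq> Omega n r" and face: "set_mset (pool M) \<in> \<Delta>"
        by (auto simp: face_multisets_def edgewise_subdivision_def set_mset_pool)
      then have "set_mset (pool M) \<subseteq> {1..n}" using assms by auto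
      then have "int (size (pool M)) = (\<Sum>a\<in>#M. iota a n)"
        using iota_pool[OF sub] by (simp flip: iota_count_eq_size)
      also have "\<dots> = (\<Sum>a\<in>#M. int r)"
        using sub by (intro arg_cong[of _ _ sum_mset] image_mset_cong) (auto simp: iota_Omega)
      finally have "int (size (pool M)) = int (r * m)"
        using M by (simp add: face_multisets_def)
      with face show "pool M \<in> face_multisets \<Delta> (r * m)"
        by (simp only: face_multisets_def of_nat_eq_iff mem_Collect_eq)
    qed
  qed
qed

lemma finite_Omega: "finite (Omega n r)"
proof (rule finite_subset)
  show "Omega n r \<subseteq> {f. \<forall>k. (k \<in> {1..n} \<longrightarrow> f k \<in> {..r}) \<and> (k \<notin> {1..n} \<longrightarrow> f k = 0)}"
    by (auto simp: Omega_def intro: member_le_sum)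
  show "finite {f. \<forall>k. (k \<in> {1..n} \<longrightarrow> f k \<in> {..r}) \<and> (k \<notin> {1..n} \<longrightarrow> f k = (0::nat))}"
    by (intro finite_set_of_finite_funs) auto
qed

lemma simplicial_complex_edgewise:
  assumes "simplicial_complex \<Delta>"
  shows "simplicial_complex (edgewise_subdivision n r \<Delta>)"
  unfolding simplicial_complex_def
proof (intro conjI ballI allI impI)
  show "finite (edgewise_subdivision n r \<Delta>)"
    by (rule finite_subset[of _ "Pow (Omega n r)"])
       (auto simp: edgewise_subdivision_def finite_Omega)
  show "{} \<in> edgewise_subdivision n r \<Delta>"
    using assms by (auto simp: edgewise_subdivision_def simplicial_complex_def)
next
  fix S assume S: "S \<in> edgewise_subdivision n r \<Delta>"
  then show "finite S"
    using finite_Omega finite_subset by (auto simp: edgewise_subdivision_def)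
  fix T assume "T \<subseteq> S"
  moreover from this have "(\<Union>a\<in>T. supp a) \<in> \<Delta>"
    using S assms unfolding edgewise_subdivision_def simplicial_complex_def
    by (metis (no_types, lifting) UN_mono mem_Collect_eq order_refl)
  ultimately show "T \<in> edgewise_subdivision n r \<Delta>"
    using S unfolding edgewise_subdivision_def by blast
qed

section \<open>The coefficients of a power of a truncated geometric series\<close>

text \<open>The coefficient of \<open>X\<^sup>m\<close> in \<open>(1 + X + \<dots> + X\<^sup>r\<^sup>-\<^sup>1)\<^sup>d\<close>, equivalently the number of points with
  coordinate sum \<open>m\<close> in the box \<open>{0..<r}\<^sup>d\<close>. The argument is an integer because the matrix
  \<open>box_count r d (r i - j)\<close> reaches into negative indices, where the value has to be \<open>0\<close>.\<close>

primrec box_count :: "nat \<Rightarrow> nat \<Rightarrow> int \<Rightarrow> int" where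
  "box_count r 0 m = (if m = 0 then 1 else 0)"
| "box_count r (Suc d) m = (\<Sum>s<r. box_count r d (m - int s))"

lemma box_count_nonneg: "0 \<le> box_count r d m"
  by (induction d arbitrary: m) (auto intro: sum_nonneg)

lemma box_count_negative: "m < 0 \<Longrightarrow> box_count r d m = 0"
  by (induction d arbitrary: m) auto

text \<open>The reflection \<open>s \<mapsto> r - 1 - s\<close> of every coordinate maps the box to itself.\<close>

lemma box_count_symmetric:
  assumes "r \<ge> 1"
  shows "box_count r d (int d * (int r - 1) - m) = box_count r d m"
proof (induction d arbitrary: m)
  case (Suc d)
  have "box_count r (Suc d) (int (Suc d) * (int r - 1) - m)
      = (\<Sum>s<r. box_count r d (m - int (r - Suc s)))"
    unfolding box_count.simps
  proof (rule sum.cong)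
    fix s assume "s \<in> {..<r}"
    then have eq: "int (Suc d) * (int r - 1) - m - int s = int d * (int r - 1) - (m - int (r - Suc s))"
      by (simp add: of_nat_diff algebra_simps)
    show "box_count r d (int (Suc d) * (int r - 1) - m - int s) = box_count r d (m - int (r - Suc s))"
      by (simp only: eq Suc.IH)
  qed simp
  also have "\<dots> = box_count r (Suc d) m"
    using sum.nat_diff_reindex[of "\<lambda>s. box_count r d (m - int s)" r] by simp
  finally show ?case .
qed simp

lemma box_count_large:
  assumes "r \<ge> 1" "int d * (int r - 1) < m"
  shows "box_count r d m = 0"
  using box_count_symmetric[OF assms(1), of d m] box_count_negative assms(2) by simp

lemma box_count_pos:
  assumes "r \<ge> 1" "0 \<le> m" "m \<le> int d * (int r - 1)"
  shows "0 < box_count r d m"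
  using assms(2,3)
proof (induction d arbitrary: m)
  case (Suc d)
  define s where "s = min (nat m) (r - 1)"
  have "0 \<le> int d * (int r - 1)" using assms(1) by simp
  then have s: "s < r" "0 \<le> m - int s" "m - int s \<le> int d * (int r - 1)"
    using Suc.prems assms(1) by (auto simp: s_def min_def algebra_simps of_nat_diff)
  then have "0 < box_count r d (m - int s)" by (intro Suc.IH) auto
  then show ?case
    unfolding box_count.simps
    using s(1) by (intro sum_pos2[of _ s]) (auto simp: box_count_nonneg)
qed simp

lemma box_count_generating_function:
  "((\<Sum>s<r. fps_X ^ s) ^ d :: int fps) $ m = box_count r d (int m)"
proof (induction d arbitrary: m)
  case (Suc d)
  have "((\<Sum>s<r. fps_X ^ s) ^ Suc d :: int fps) $ m
      = (\<Sum>s<r. (fps_X ^ s * (\<Sum>s<r. fps_X ^ s) ^ d) $ m)"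
    by (simp add: sum_distrib_right fps_sum_nth)
  also have "\<dots> = (\<Sum>s<r. box_count r d (int m - int s))"
    by (intro sum.cong refl) (auto simp: fps_X_power_mult_nth Suc of_nat_diff box_count_negative)
  finally show ?case by simp
qed simp

text \<open>The case of two rows and two columns of the Cauchy--Binet formula: the difference of the two
  sides is \<open>\<Sum>\<^sub>k\<^sub><\<^sub>l (a\<^sub>k b\<^sub>l - a\<^sub>l b\<^sub>k) (u\<^sub>k w\<^sub>l - u\<^sub>l w\<^sub>k)\<close>. Summing over all pairs instead
  counts each pair \<open>k < l\<close> twice.\<close>

lemma cauchy_binet_mono:
  fixes a b u w :: "'k :: linorder \<Rightarrow> int"
  assumes "\<And>k l. k \<in> K \<Longrightarrow> l \<in> K \<Longrightarrow> k < l \<Longrightarrow> a l * b k \<le> a k * b l"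
    and "\<And>k l. k \<in> K \<Longrightarrow> l \<in> K \<Longrightarrow> k < l \<Longrightarrow> u l * w k \<le> u k * w l"
  shows "(\<Sum>k\<in>K. a k * w k) * (\<Sum>k\<in>K. b k * u k) \<le> (\<Sum>k\<in>K. a k * u k) * (\<Sum>k\<in>K. b k * w k)"
proof -
  have "0 \<le> (\<Sum>k\<in>K. \<Sum>l\<in>K. (a k * b l - a l * b k) * (u k * w l - u l * w k))"
  proof (intro sum_nonneg)
    fix k l assume "k \<in> K" "l \<in> K"
    then show "0 \<le> (a k * b l - a l * b k) * (u k * w l - u l * w k)"
      using assms[of k l] assms[of l k]
      by (cases k l rule: linorder_cases) (auto intro: mult_nonneg_nonneg mult_nonpos_nonpos)
  qed
  also have "\<dots> = (\<Sum>k\<in>K. \<Sum>l\<in>K. (a k * u k) * (b l * w l)) - (\<Sum>k\<in>K. \<Sum>l\<in>K. (a k * w k) * (b l * u l))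
     - (\<Sum>k\<in>K. \<Sum>l\<in>K. (b k * u k) * (a l * w l)) + (\<Sum>k\<in>K. \<Sum>l\<in>K. (b k * w k) * (a l * u l))"
    unfolding sum_subtractf[symmetric] sum.distrib[symmetric]
    by (intro sum.cong refl) (simp add: algebra_simps)
  also have "\<dots> = 2 * ((\<Sum>k\<in>K. a k * u k) * (\<Sum>k\<in>K. b k * w k)
      - (\<Sum>k\<in>K. a k * w k) * (\<Sum>k\<in>K. b k * u k))"
    unfolding sum_product[symmetric] by (simp add: algebra_simps)
  finally show ?thesis by simp
qed

text \<open>The Toeplitz matrix of the sequence \<open>1, \<dots>, 1\<close> of length \<open>r\<close> has non-negative \<open>2 \<times> 2\<close>
  minors. Convolving sequences multiplies their Toeplitz matrices, so by Cauchy--Binet the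
  property passes to all powers. This is log-concavity in a form that also covers
  the zeros at both ends of the sequence.\<close>

lemma box_count_totally_positive:
  assumes "i \<le> i'" "j \<le> j'"
  shows "box_count r d (i - j') * box_count r d (i' - j) \<le> box_count r d (i - j) * box_count r d (i' - j')"
  using assms
proof (induction d arbitrary: i i' j j')
  case (Suc d)
  define g where "g s = (if 0 \<le> s \<and> s < int r then 1 else 0 :: int)" for s :: int
  \<comment> \<open>The convolution as a sum over one finite range of \<open>k\<close> that serves both columns \<open>j\<close> and \<open>j'\<close>.\<close>
  have conv: "box_count r (Suc d) (p - q) = (\<Sum>k\<in>{j..j' + int r}. box_count r d (p - k) * g (k - q))"
    if "j \<le> q" "q \<le> j'" for p q
  proof -
    have "(\<Sum>k\<in>{j..j' + int r}. box_count r d (p - k) * g (k - q))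
        = (\<Sum>k\<in>(\<lambda>s. q + int s) ` {..<r}. box_count r d (p - k))"
    proof (rule sum.mono_neutral_cong_right)
      show "\<forall>k\<in>{j..j' + int r} - (\<lambda>s. q + int s) ` {..<r}. box_count r d (p - k) * g (k - q) = 0"
      proof
        fix k assume k: "k \<in> {j..j' + int r} - (\<lambda>s. q + int s) ` {..<r}"
        have "k = q + int (nat (k - q)) \<and> nat (k - q) < r" if "0 \<le> k - q" "k - q < int r"
          using that by auto
        with k have "\<not> (0 \<le> k - q \<and> k - q < int r)" by blast
        then show "box_count r d (p - k) * g (k - q) = 0" by (auto simp: g_def)
      qed
    qed (use that in \<open>auto simp: g_def\<close>)
    also have "\<dots> = (\<Sum>s<r. box_count r d (p - q - int s))"
      by (subst sum.reindex) (auto simp: inj_on_def algebra_simps)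
    finally show ?thesis by simp
  qed
  have "g (l - j) * g (k - j') \<le> g (k - j) * g (l - j')" if "k < l" for k l
    using that Suc.prems(2) by (auto simp: g_def)
  moreover have "box_count r d (i - l) * box_count r d (i' - k) \<le> box_count r d (i - k) * box_count r d (i' - l)"
    if "k < l" for k l
    using Suc.IH[OF Suc.prems(1), of k l] that by simp
  ultimately show ?case
    using Suc.prems(2) by (simp only: conv order_refl cauchy_binet_mono)
qed auto

section \<open>The linear map on h-vectors\<close>

definition box_transform :: "nat \<Rightarrow> nat \<Rightarrow> (nat \<Rightarrow> int) \<Rightarrow> nat \<Rightarrow> int" where
  "box_transform r d h i = (\<Sum>j\<le>d. box_count r d (int (r * i) - int j) * h j)"

text \<open>If the ratios \<open>u\<^sub>j / w\<^sub>j\<close> increase with \<open>j\<close>, then so do those of the images of \<open>u\<close> and \<open>w\<close>.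
  The hypothesis and the conclusion are cross-multiplied, so that zero entries are admitted.\<close>

lemma box_transform_ratio_mono:
  assumes "\<And>j k. j < k \<Longrightarrow> k \<le> d \<Longrightarrow> u j * w k \<le> u k * w j" "i \<le> i'"
  shows "box_transform r d u i * box_transform r d w i' \<le> box_transform r d u i' * box_transform r d w i"
proof -
  have "box_count r d (int (r * i) - int l) * box_count r d (int (r * i') - int k)
      \<le> box_count r d (int (r * i) - int k) * box_count r d (int (r * i') - int l)" if "k < l" for k l
    using that assms(2) by (intro box_count_totally_positive) (auto intro: mult_left_mono)
  then show ?thesis
    unfolding box_transform_def
    using cauchy_binet_mono[of "{..d}" "\<lambda>j. box_count r d (int (r * i) - int j)"
      "\<lambda>j. box_count r d (int (r * i') - int j)" w u] assms(1)
    by (simp add: mult.commute)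
qed

lemma box_transform_reverse:
  assumes "r \<ge> 1" "i \<le> d"
  shows "box_transform r d h (d - i) = box_transform r d (\<lambda>j. h (d - j)) i"
proof -
  have "box_transform r d h (d - i) = (\<Sum>j\<le>d. box_count r d (int (r * (d - i)) - int (d - j)) * h (d - j))"
    unfolding box_transform_def by (rule sum.reindex_bij_witness[of _ "\<lambda>j. d - j" "\<lambda>j. d - j"]) auto
  also have "\<dots> = box_transform r d (\<lambda>j. h (d - j)) i"
    unfolding box_transform_def
  proof (intro sum.cong refl)
    fix j assume "j \<in> {..d}"
    then have "int (r * (d - i)) - int (d - j) = int d * (int r - 1) - (int (r * i) - int j)"
      using assms(2) by (simp add: of_nat_diff algebra_simps)
    then show "box_count r d (int (r * (d - i)) - int (d - j)) * h (d - j)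
        = box_count r d (int (r * i) - int j) * h (d - j)"
      by (simp only: box_count_symmetric[OF assms(1)])
  qed
  finally show ?thesis .
qed

lemma box_transform_nonneg:
  "(\<And>j. j \<le> d \<Longrightarrow> 0 \<le> h j) \<Longrightarrow> 0 \<le> box_transform r d h i"
  unfolding box_transform_def by (auto intro!: sum_nonneg mult_nonneg_nonneg box_count_nonneg)

text \<open>The diagonal entries \<open>box_count r d ((r - 1) i)\<close> of the matrix are positive.\<close>

lemma box_transform_pos:
  assumes "r \<ge> 1" "i \<le> d" "0 < h i" "\<And>j. j \<le> d \<Longrightarrow> 0 \<le> h j"
  shows "0 < box_transform r d h i"
proof -
  have "0 \<le> int i * (int r - 1)" "int i * (int r - 1) \<le> int d * (int r - 1)"
    using assms(1,2) by (auto intro: mult_right_mono)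
  then have "0 < box_count r d (int (r * i) - int i)"
    using assms(1) by (intro box_count_pos) (auto simp: algebra_simps)
  then show ?thesis
    unfolding box_transform_def using assms
    by (intro sum_pos2[of _ i]) (auto intro!: mult_nonneg_nonneg box_count_nonneg)
qed

text \<open>In the row \<open>d\<close> only the last entry of the matrix can differ from \<open>0\<close>, since
  \<open>(1 + X + \<dots> + X\<^sup>r\<^sup>-\<^sup>1)\<^sup>d\<close> has degree \<open>d (r - 1)\<close>.\<close>

lemma box_transform_top:
  assumes "r \<ge> 1" "h d = 0"
  shows "box_transform r d h d = 0"
  unfolding box_transform_def
proof (intro sum.neutral ballI)
  fix j assume "j \<in> {..d}"
  then show "box_count r d (int (r * d) - int j) * h j = 0"
    using assms by (cases "j = d") (auto simp: algebra_simps intro: box_count_large)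
qed

lemma box_transform_beyond:
  assumes "r \<ge> 1" "d < i"
  shows "box_transform r d h i = 0"
  unfolding box_transform_def
proof (intro sum.neutral ballI)
  fix j assume "j \<in> {..d}"
  have "int r * (int d + 1) \<le> int r * int i" using assms by (intro mult_left_mono) auto
  then have "int d * (int r - 1) < int (r * i) - int j"
    using \<open>j \<in> {..d}\<close> assms(1) by (simp add: algebra_simps)
  then show "box_count r d (int (r * i) - int j) * h j = 0"
    by (simp add: box_count_large[OF assms(1)])
qed

section \<open>The h-vector of the edgewise subdivision\<close>

definition fps_section :: "nat \<Rightarrow> int fps \<Rightarrow> int fps" where
  "fps_section r A = Abs_fps (\<lambda>m. A $ (r * m))"

text \<open>Extracting the exponents divisible by \<open>r\<close> is linear over power series in \<open>X\<^sup>r\<close>, which become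
  power series in \<open>X\<close>.\<close>

lemma fps_section_mult:
  assumes "r \<ge> 1"
  shows "fps_section r ((1 - fps_X ^ r) ^ d * A) = (1 - fps_X) ^ d * fps_section r A"
proof (induction d)
  case (Suc d)
  have "fps_section r ((1 - fps_X ^ r) * B) = (1 - fps_X) * fps_section r B" for B
  proof (rule fps_ext)
    fix m show "fps_section r ((1 - fps_X ^ r) * B) $ m = ((1 - fps_X) * fps_section r B) $ m"
      using assms by (cases m) (auto simp: fps_section_def left_diff_distrib fps_X_power_mult_nth)
  qed
  then show ?case by (simp add: Suc mult.assoc)
qed simp

lemma hilbert_series_edgewise:
  assumes \<Delta>: "simplicial_complex \<Delta>" "complex_dim \<Delta> = int d - 1" "\<Union>\<Delta> \<subseteq> {1..n}" and r: "r \<ge> 1"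
  shows "(1 - fps_X) ^ d * hilbert_series (edgewise_subdivision n r \<Delta>)
    = fps_of_poly (\<Sum>i\<le>d. monom (box_transform r d (h_vector \<Delta>) i) i)"
proof -
  have "hilbert_series (edgewise_subdivision n r \<Delta>) = fps_section r (hilbert_series \<Delta>)"
    by (rule fps_ext) (simp add: fps_section_def card_face_multisets_edgewise[OF \<Delta>(3) r])
  then have "(1 - fps_X) ^ d * hilbert_series (edgewise_subdivision n r \<Delta>)
      = fps_section r ((1 - fps_X ^ r) ^ d * hilbert_series \<Delta>)"
    by (simp add: fps_section_mult[OF r])
  also have "(1 - fps_X ^ r) ^ d * hilbert_series \<Delta>
      = (1 - fps_X) ^ d * hilbert_series \<Delta> * (\<Sum>s<r. fps_X ^ s) ^ d"
    unfolding one_diff_power_eq by (simp only: power_mult_distrib mult_ac)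
  also have "\<dots> = fps_of_poly (h_numerator d \<Delta>) * (\<Sum>s<r. fps_X ^ s) ^ d"
    using hilbert_series_numerator[OF \<Delta>(1) card_le_dim[OF \<Delta>(1,2)]] by simp
  also have "fps_section r \<dots> = fps_of_poly (\<Sum>i\<le>d. monom (box_transform r d (h_vector \<Delta>) i) i)"
  proof (rule fps_ext)
    fix i
    have fin: "finite \<Delta>" using \<Delta>(1) by (simp add: simplicial_complex_def)
    have "fps_section r (fps_of_poly (h_numerator d \<Delta>) * (\<Sum>s<r. fps_X ^ s) ^ d) $ i
        = (\<Sum>j\<le>r * i. coeff (h_numerator d \<Delta>) j * box_count r d (int (r * i) - int j))"
      by (simp add: fps_section_def fps_mult_nth box_count_generating_function of_nat_diff atLeast0AtMost)
    also have "\<dots> = (\<Sum>j\<le>max d (r * i). coeff (h_numerator d \<Delta>) j * box_count r d (int (r * i) - int j))"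
      by (rule sum.mono_neutral_left) (auto simp: box_count_negative simp del: of_nat_mult)
    also have "\<dots> = (\<Sum>j\<le>d. coeff (h_numerator d \<Delta>) j * box_count r d (int (r * i) - int j))"
      using degree_h_numerator[OF fin card_le_dim[OF \<Delta>(1,2)]]
      by (intro sum.mono_neutral_right) (auto simp: coeff_eq_0)
    also have "\<dots> = box_transform r d (h_vector \<Delta>) i"
      unfolding box_transform_def
      by (intro sum.cong refl) (simp add: h_vector_eq_coeff_numerator[OF \<Delta>(1,2)])
    also have "\<dots> = coeff (\<Sum>i\<le>d. monom (box_transform r d (h_vector \<Delta>) i) i) i"
      using box_transform_beyond[OF r, of d i] by (cases "i \<le> d") (auto simp: coeff_sum)
    finally show "fps_section r (fps_of_poly (h_numerator d \<Delta>) * (\<Sum>s<r. fps_X ^ s) ^ d) $ i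
        = fps_of_poly (\<Sum>i\<le>d. monom (box_transform r d (h_vector \<Delta>) i) i) $ i" by simp
  qed
  finally show ?thesis .
qed

text \<open>Non-negativity of the \<open>h\<close>-vector enters through the dimension: with \<open>h\<^sub>0 = 1\<close> it makes the
  numerator of the Hilbert series positive at \<open>1\<close>, so the pole there keeps its order \<open>d\<close>.\<close>

lemma edgewise_h_vector:
  assumes \<Delta>: "simplicial_complex \<Delta>" "complex_dim \<Delta> = int d - 1" "\<Union>\<Delta> \<subseteq> {1..n}" and r: "r \<ge> 1"
    and nonneg: "\<And>i. i \<le> d \<Longrightarrow> 0 \<le> h_vector \<Delta> i"
  shows complex_dim_edgewise: "complex_dim (edgewise_subdivision n r \<Delta>) = int d - 1"
    and h_vector_edgewise: "\<And>i. i \<le> d \<Longrightarrow>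
      h_vector (edgewise_subdivision n r \<Delta>) i = box_transform r d (h_vector \<Delta>) i"
proof -
  let ?E = "edgewise_subdivision n r \<Delta>"
  define p where "p = (\<Sum>i\<le>d. monom (box_transform r d (h_vector \<Delta>) i) i)"
  note series = hilbert_series_edgewise[OF \<Delta> r, folded p_def]
  have E: "simplicial_complex ?E" by (rule simplicial_complex_edgewise[OF \<Delta>(1)])
  have "poly p 1 = (\<Sum>i\<le>d. box_transform r d (h_vector \<Delta>) i)"
    by (simp add: p_def poly_sum poly_monom)
  also have "\<dots> > 0"
    using r nonneg by (intro sum_pos2[of _ 0])
      (auto intro!: box_transform_pos box_transform_nonneg simp: h_vector_0[OF \<Delta>(1,2)])
  finally show dim: "complex_dim ?E = int d - 1"
    by (intro complex_dim_eqI[OF E series]) simp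
  have "fps_of_poly (h_numerator d ?E) = fps_of_poly p"
    using hilbert_series_numerator[OF E card_le_dim[OF E dim]] series by simp
  then have "h_numerator d ?E = p" by (simp only: fps_of_poly_eq_iff)
  then show "h_vector ?E i = box_transform r d (h_vector \<Delta>) i" if "i \<le> d" for i
    using that by (simp add: h_vector_eq_coeff_numerator[OF E dim that] p_def coeff_sum)
qed

section \<open>Monotone ratios under edgewise subdivision\<close>

lemma
  assumes "simplicial_complex \<Delta>" "inj_on v (\<Union>\<Delta>)"
  shows simplicial_complex_image: "simplicial_complex ((`) v ` \<Delta>)"
    and complex_dim_image: "complex_dim ((`) v ` \<Delta>) = complex_dim \<Delta>"
    and h_vector_image: "h_vector ((`) v ` \<Delta>) = h_vector \<Delta>"
proof -
  show "simplicial_complex ((`) v ` \<Delta>)"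
    unfolding simplicial_complex_def
  proof (intro conjI ballI allI impI)
    fix G H assume "G \<in> (`) v ` \<Delta>" "H \<subseteq> G"
    then obtain F where "F \<in> \<Delta>" "H \<subseteq> v ` F" by auto
    then show "H \<in> (`) v ` \<Delta>"
      using assms(1) unfolding simplicial_complex_def subset_image_iff by blast
  qed (use assms(1) in \<open>auto simp: simplicial_complex_def\<close>)
  have inj: "inj_on v F" if "F \<in> \<Delta>" for F
    using assms(2) that by (rule inj_on_subset[OF _ Union_upper])
  have face_dim: "face_dim (v ` F) = face_dim F" if "F \<in> \<Delta>" for F
    using inj[OF that] by (simp add: face_dim_def card_image)
  then show dim: "complex_dim ((`) v ` \<Delta>) = complex_dim \<Delta>"
    unfolding complex_dim_def image_image by (simp cong: image_cong)
  have "f_vector ((`) v ` \<Delta>) i = f_vector \<Delta> i" for i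
  proof -
    have "{G \<in> (`) v ` \<Delta>. face_dim G = i} = (`) v ` {F \<in> \<Delta>. face_dim F = i}"
      using face_dim by auto
    moreover have "inj_on ((`) v) {F \<in> \<Delta>. face_dim F = i}"
      using assms(2) by (intro inj_on_image) (auto intro: inj_on_subset)
    ultimately show ?thesis by (simp add: f_vector_def card_image)
  qed
  then show "h_vector ((`) v ` \<Delta>) = h_vector \<Delta>"
    by (simp add: fun_eq_iff h_vector_def h_poly_def dim)
qed

lemma h_ratio_le_iff:
  assumes "0 < h_vector \<Gamma> j" "0 < h_vector \<Gamma> l"
  shows "h_ratio \<Gamma> i j \<le> h_ratio \<Gamma> k l \<longleftrightarrow> h_vector \<Gamma> i * h_vector \<Gamma> l \<le> h_vector \<Gamma> k * h_vector \<Gamma> j"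
  using assms by (simp add: h_ratio_def divide_le_eq pos_le_divide_eq flip: of_int_mult)

lemma condition_a_edgewise:
  assumes a: "condition_a d \<Delta>" and \<Delta>: "\<Union>\<Delta> \<subseteq> {1..n}" and r: "r \<ge> 1"
  shows "condition_a d (edgewise_subdivision n r \<Delta>)"
proof -
  let ?E = "edgewise_subdivision n r \<Delta>" and ?h = "h_vector \<Delta>"
  have cplx: "simplicial_complex \<Delta>" "complex_dim \<Delta> = int d - 1"
    using a by (auto simp: condition_a_def)
  have pos: "0 < ?h i" if "i \<le> d" for i
    using a that by (auto simp: condition_a_def)
  have nonneg: "0 \<le> ?h i" if "i \<le> d" for i using pos[OF that] by simp
  note E = edgewise_h_vector[OF cplx \<Delta> r nonneg]
  have chain: "h_ratio \<Delta> j (d - j) \<le> h_ratio \<Delta> k (d - k)" if "j \<le> k" "k \<le> d" for j k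
    using that
  proof (induction k rule: dec_induct)
    case (step m)
    then show ?case using a unfolding condition_a_def by (force intro: order_trans)
  qed simp
  have E_pos: "0 < h_vector ?E i" if "i \<le> d" for i
    using that by (simp add: E(2) box_transform_pos[OF r] pos nonneg)
  have "h_ratio ?E i (d - i) \<le> h_ratio ?E (i + 1) (d - (i + 1))" if "i < d" for i
  proof -
    have "box_transform r d ?h i * box_transform r d (\<lambda>j. ?h (d - j)) (i + 1)
        \<le> box_transform r d ?h (i + 1) * box_transform r d (\<lambda>j. ?h (d - j)) i"
    proof (rule box_transform_ratio_mono)
      fix j k assume "j < k" "k \<le> d"
      then show "?h j * ?h (d - k) \<le> ?h k * ?h (d - j)"
        using chain[of j k] by (simp add: h_ratio_le_iff pos)
    qed simp
    then show ?thesis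
      unfolding h_ratio_le_iff[OF E_pos E_pos, OF diff_le_self diff_le_self]
      using that by (simp add: E(2) box_transform_reverse[OF r])
  qed
  then show ?thesis
    using simplicial_complex_edgewise[OF cplx(1)] E(1) E_pos by (simp add: condition_a_def)
qed

lemma condition_b_edgewise:
  assumes b: "condition_b d \<Delta>" and d: "d \<ge> 1" and \<Delta>: "\<Union>\<Delta> \<subseteq> {1..n}" and r: "r \<ge> 1"
  shows "condition_b d (edgewise_subdivision n r \<Delta>)"
proof -
  let ?E = "edgewise_subdivision n r \<Delta>" and ?h = "h_vector \<Delta>"
  have cplx: "simplicial_complex \<Delta>" "complex_dim \<Delta> = int d - 1" and top: "?h d = 0"
    using b by (auto simp: condition_b_def)
  have inner: "0 < ?h i" if "1 \<le> i" "i < d" for i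
    using b that by (auto simp: condition_b_def)
  have bottom: "?h 0 = 1" by (rule h_vector_0[OF cplx])
  have nonneg: "0 \<le> ?h i" if "i \<le> d" for i
    using inner[of i] top bottom that by (cases "i = 0"; cases "i = d") auto
  note E = edgewise_h_vector[OF cplx \<Delta> r nonneg]
  have chain: "h_ratio \<Delta> k (d - k) \<le> h_ratio \<Delta> j (d - j)" if "j \<le> k" "1 \<le> j" "k < d" for j k
    using that
  proof (induction k rule: dec_induct)
    case (step m)
    then have "h_ratio \<Delta> (m + 1) (d - (m + 1)) \<le> h_ratio \<Delta> m (d - m)"
      using b unfolding condition_b_def by auto
    with step show ?case by simp
  qed simp
  \<comment> \<open>The pairs with \<open>j = 0\<close> or \<open>k = d\<close>, about which the chain says nothing, are settled by \<open>h\<^sub>d = 0\<close>.\<close>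
  have products: "?h (d - j) * ?h k \<le> ?h (d - k) * ?h j" if jk: "j < k" "k \<le> d" for j k
  proof -
    consider "j = 0" | "k = d" | "1 \<le> j" "k < d" using jk by linarith
    then show ?thesis
    proof cases
      case 3
      then show ?thesis
        using chain[of j k] jk inner by (simp add: h_ratio_le_iff mult.commute)
    qed (use jk nonneg in \<open>simp_all add: top\<close>)
  qed
  have E_pos: "0 < h_vector ?E i" if "1 \<le> i" "i < d" for i
    using that by (simp add: E(2) box_transform_pos[OF r] inner nonneg)
  have "h_ratio ?E (i + 1) (d - (i + 1)) \<le> h_ratio ?E i (d - i)" if "1 \<le> i" "i < d - 1" for i
  proof -
    have "box_transform r d (\<lambda>j. ?h (d - j)) i * box_transform r d ?h (i + 1)
        \<le> box_transform r d (\<lambda>j. ?h (d - j)) (i + 1) * box_transform r d ?h i"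
      by (rule box_transform_ratio_mono) (use products in auto)
    moreover have "0 < h_vector ?E (d - i)" "0 < h_vector ?E (d - (i + 1))"
      using that by (auto intro!: E_pos)
    ultimately show ?thesis
      using that by (subst h_ratio_le_iff) (simp_all add: E(2) box_transform_reverse[OF r] mult.commute)
  qed
  then show ?thesis
    using simplicial_complex_edgewise[OF cplx(1)] E E_pos box_transform_top[OF r, of ?h d] top d
    by (auto simp: condition_b_def)
qed

theorem corollary2p6:
  fixes d r n :: nat and \<Delta> :: "'a set set" and v :: "'a \<Rightarrow> nat"
  assumes "d \<ge> 1" and "r \<ge> 1"
    and "simplicial_complex \<Delta>" and "complex_dim \<Delta> = int d - 1"
    and "bij_betw v (\<Union>\<Delta>) {1..n}"
  shows "(condition_a d \<Delta> \<longrightarrow> condition_a d (edgewise_subdivision n r ((`) v ` \<Delta>))) \<and>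
         (condition_b d \<Delta> \<longrightarrow> condition_b d (edgewise_subdivision n r ((`) v ` \<Delta>)))"
proof -
  have inj: "inj_on v (\<Union>\<Delta>)" and vertices: "\<Union>((`) v ` \<Delta>) \<subseteq> {1..n}"
    using assms(5) by (auto simp: bij_betw_def)
  note image = simplicial_complex_image[OF assms(3) inj] complex_dim_image[OF assms(3) inj]
    h_vector_image[OF assms(3) inj]
  have "condition_a d ((`) v ` \<Delta>)" if "condition_a d \<Delta>"
    using that image by (simp add: condition_a_def h_ratio_def)
  moreover have "condition_b d ((`) v ` \<Delta>)" if "condition_b d \<Delta>"
    using that image by (simp add: condition_b_def h_ratio_def)
  ultimately show ?thesis
    using condition_a_edgewise condition_b_edgewise vertices assms(1,2) by blast
qed

end
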